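(* Let $(T,+,\Gamma)$ be a commutative ternary $\Gamma$-semiring and let $J(T)=\bigcap\{M\subset T\mid M\text{ is a maximal ideal of }T\}$. Then: (i) $J(T)$ is contained in every maximal ideal of $T$; (ii) if all maximal ideals of $T$ are prime, then $J(T)$ is semiprime; (iii) $J(T)=\{0\}$ if and only if the intersection of all maximal ideals is trivial, i.e., $T$ is semisimple.
   Context: A ternary $\Gamma$-semiring $(T,+,\Gamma)$ consists of a set $T$, an addition $+$, a set $\Gamma$ of parameters, and a map $T\times\Gamma\times T\times\Gamma\times T\to T$, $(a,\alpha,b,\beta,c)\mapsto a_{\alpha}b_{\beta}c$, such that: $(T,+)$ is a commutative semigroup with identity element $0$; $(a_{\alpha}b_{\beta}c)_{\gamma}d_{\delta}e=a_{\alpha}b_{\beta}(c_{\gamma}d_{\delta}e)$; the product is additive in each of its three $T$-variables; and $0_{\alpha}b_{\beta}c=a_{\alpha}0_{\beta}c=a_{\alpha}b_{\beta}0=0$. It is commutative if $a_{\alpha}b_{\beta}c=b_{\beta}a_{\alpha}c=c_{\alpha}b_{\beta}a$ for all $a,b,c\in T$, $\alpha,\beta\in\Gamma$. An ideal is a nonempty $I\subseteq T$ closed under $+$ such that $a_{\alpha}b_{\beta}c\in I$ whenever at least one of $a,b,c\in T$ lies in $I$ (all $\alpha,\beta\in\Gamma$). An ideal $P\ne T$ is prime if for all $a,b,c\in T$, $\alpha,\beta\in\Gamma$: $a_{\alpha}b_{\beta}c\in P$ implies $a\in P$ or $b\in P$ or $c\in P$. An ideal $Q\neq T$ is semiprime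 if for all $a\in T$, $\alpha,\beta\in\Gamma$: $a_{\alpha}a_{\beta}a\in Q$ implies $a\in Q$. An ideal $M\neq T$ is maximal if there is no ideal $I$ with $M\subsetneq I\subsetneq T$. $T$ is semisimple if the intersection of all its maximal ideals is $\{0\}$.
   Formalization: Part (ii) is proved assuming that Γ is nonempty and that T has at least one maximal ideal; it fails otherwise: for T={0}, J(T)=T is not proper, and for Γ empty, T={0,a} with a+a=a, the maximal ideals {0} and {a} have empty intersection. *)

theory Defs
  imports "HOL-Algebra.Group"
begin

record ('a, 'g) ternary_gamma = "'a partial_object" +
  tplus :: "'a \<Rightarrow> 'a \<Rightarrow> 'a"
  tzero :: 'a
  params :: "'g set"
  tprod :: "'a \<Rightarrow> 'g \<Rightarrow> 'a \<Rightarrow> 'g \<Rightarrow> 'a \<Rightarrow> 'a"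

abbreviation additive_monoid :: "('a, 'g, 'm) ternary_gamma_scheme \<Rightarrow> 'a monoid" where
  "additive_monoid T \<equiv> \<lparr>carrier = carrier T, mult = tplus T, one = tzero T\<rparr>"

text \<open>No structure is imposed on the parameter set, which may be empty.\<close>

locale ternary_gamma_semiring =
  fixes T :: "('a, 'g, 'm) ternary_gamma_scheme" (structure)
  assumes additive: "comm_monoid (additive_monoid T)"
    and tprod_closed:
      "\<lbrakk>a \<in> carrier T; b \<in> carrier T; c \<in> carrier T; \<alpha> \<in> params T; \<beta> \<in> params T\<rbrakk>
        \<Longrightarrow> tprod T a \<alpha> b \<beta> c \<in> carrier T"
    and tprod_assoc:
      "\<lbrakk>a \<in> carrier T; b \<in> carrier T; c \<in> carrier T; d \<in> carrier T; e \<in> carrier T;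
        \<alpha> \<in> params T; \<beta> \<in> params T; \<gamma> \<in> params T; \<delta> \<in> params T\<rbrakk>
        \<Longrightarrow> tprod T (tprod T a \<alpha> b \<beta> c) \<gamma> d \<delta> e = tprod T a \<alpha> b \<beta> (tprod T c \<gamma> d \<delta> e)"
    and tprod_add1:
      "\<lbrakk>a \<in> carrier T; a' \<in> carrier T; b \<in> carrier T; c \<in> carrier T; \<alpha> \<in> params T; \<beta> \<in> params T\<rbrakk>
        \<Longrightarrow> tprod T (tplus T a a') \<alpha> b \<beta> c = tplus T (tprod T a \<alpha> b \<beta> c) (tprod T a' \<alpha> b \<beta> c)"
    and tprod_add2:
      "\<lbrakk>a \<in> carrier T; b \<in> carrier T; b' \<in> carrier T; c \<in> carrier T; \<alpha> \<in> params T; \<beta> \<in> params T\<rbrakk>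
        \<Longrightarrow> tprod T a \<alpha> (tplus T b b') \<beta> c = tplus T (tprod T a \<alpha> b \<beta> c) (tprod T a \<alpha> b' \<beta> c)"
    and tprod_add3:
      "\<lbrakk>a \<in> carrier T; b \<in> carrier T; c \<in> carrier T; c' \<in> carrier T; \<alpha> \<in> params T; \<beta> \<in> params T\<rbrakk>
        \<Longrightarrow> tprod T a \<alpha> b \<beta> (tplus T c c') = tplus T (tprod T a \<alpha> b \<beta> c) (tprod T a \<alpha> b \<beta> c')"
    and tprod_zero1:
      "\<lbrakk>b \<in> carrier T; c \<in> carrier T; \<alpha> \<in> params T; \<beta> \<in> params T\<rbrakk>
        \<Longrightarrow> tprod T (tzero T) \<alpha> b \<beta> c = tzero T"
    and tprod_zero2:
      "\<lbrakk>a \<in> carrier T; c \<in> carrier T; \<alpha> \<in> params T; \<beta> \<in> params T\<rbrakk>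
        \<Longrightarrow> tprod T a \<alpha> (tzero T) \<beta> c = tzero T"
    and tprod_zero3:
      "\<lbrakk>a \<in> carrier T; b \<in> carrier T; \<alpha> \<in> params T; \<beta> \<in> params T\<rbrakk>
        \<Longrightarrow> tprod T a \<alpha> b \<beta> (tzero T) = tzero T"

locale comm_ternary_gamma_semiring = ternary_gamma_semiring +
  assumes tprod_comm12:
      "\<lbrakk>a \<in> carrier T; b \<in> carrier T; c \<in> carrier T; \<alpha> \<in> params T; \<beta> \<in> params T\<rbrakk>
        \<Longrightarrow> tprod T a \<alpha> b \<beta> c = tprod T b \<alpha> a \<beta> c"
    and tprod_comm13:
      "\<lbrakk>a \<in> carrier T; b \<in> carrier T; c \<in> carrier T; \<alpha> \<in> params T; \<beta> \<in> params T\<rbrakk>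
        \<Longrightarrow> tprod T a \<alpha> b \<beta> c = tprod T c \<alpha> b \<beta> a"

definition tideal :: "('a, 'g, 'm) ternary_gamma_scheme \<Rightarrow> 'a set \<Rightarrow> bool" where
  "tideal T I \<longleftrightarrow>
     I \<noteq> {} \<and> I \<subseteq> carrier T \<and>
     (\<forall>a\<in>I. \<forall>b\<in>I. tplus T a b \<in> I) \<and>
     (\<forall>a\<in>carrier T. \<forall>b\<in>carrier T. \<forall>c\<in>carrier T. \<forall>\<alpha>\<in>params T. \<forall>\<beta>\<in>params T.
        a \<in> I \<or> b \<in> I \<or> c \<in> I \<longrightarrow> tprod T a \<alpha> b \<beta> c \<in> I)"

definition prime_tideal :: "('a, 'g, 'm) ternary_gamma_scheme \<Rightarrow> 'a set \<Rightarrow> bool" where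
  "prime_tideal T P \<longleftrightarrow>
     tideal T P \<and> P \<noteq> carrier T \<and>
     (\<forall>a\<in>carrier T. \<forall>b\<in>carrier T. \<forall>c\<in>carrier T. \<forall>\<alpha>\<in>params T. \<forall>\<beta>\<in>params T.
        tprod T a \<alpha> b \<beta> c \<in> P \<longrightarrow> a \<in> P \<or> b \<in> P \<or> c \<in> P)"

definition semiprime_tideal :: "('a, 'g, 'm) ternary_gamma_scheme \<Rightarrow> 'a set \<Rightarrow> bool" where
  "semiprime_tideal T Q \<longleftrightarrow>
     tideal T Q \<and> Q \<noteq> carrier T \<and>
     (\<forall>a\<in>carrier T. \<forall>\<alpha>\<in>params T. \<forall>\<beta>\<in>params T. tprod T a \<alpha> a \<beta> a \<in> Q \<longrightarrow> a \<in> Q)"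

definition maximal_tideal :: "('a, 'g, 'm) ternary_gamma_scheme \<Rightarrow> 'a set \<Rightarrow> bool" where
  "maximal_tideal T M \<longleftrightarrow>
     tideal T M \<and> M \<noteq> carrier T \<and> \<not> (\<exists>I. tideal T I \<and> M \<subset> I \<and> I \<subset> carrier T)"

text \<open>Intersections of ideals are taken inside \<^term>\<open>carrier T\<close>, so the radical of a structure
  without maximal ideals is \<^term>\<open>carrier T\<close>.\<close>

definition jacobson_radical :: "('a, 'g, 'm) ternary_gamma_scheme \<Rightarrow> 'a set" where
  "jacobson_radical T = carrier T \<inter> \<Inter>{M. maximal_tideal T M}"

definition semisimple :: "('a, 'g, 'm) ternary_gamma_scheme \<Rightarrow> bool" where
  "semisimple T \<longleftrightarrow> carrier T \<inter> \<Inter>{M. maximal_tideal T M} = {tzero T}"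

end

theory Submission
  imports Defs
begin

text \<open>An ideal is only required to be nonempty. It contains \<open>0\<close> because it absorbs
  \<open>0\<^sub>\<alpha>0\<^sub>\<alpha>x = 0\<close> for any of its elements \<open>x\<close>, which takes a parameter \<open>\<alpha>\<close>; hence an intersection
  of ideals is again nonempty. Applying primeness to the cube of \<open>a\<close> in each maximal ideal
  separately shows that the intersection is semiprime.\<close>

lemma tidealI:
  assumes "I \<noteq> {}" and "I \<subseteq> carrier T"
    and "\<And>a b. \<lbrakk>a \<in> I; b \<in> I\<rbrakk> \<Longrightarrow> tplus T a b \<in> I"
    and "\<And>a b c \<alpha> \<beta>. \<lbrakk>a \<in> carrier T; b \<in> carrier T; c \<in> carrier T; \<alpha> \<in> params T; \<beta> \<in> params T;
      a \<in> I \<or> b \<in> I \<or> c \<in> I\<rbrakk> \<Longrightarrow> tprod T a \<alpha> b \<beta> c \<in> I"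
  shows "tideal T I"
  unfolding tideal_def by (intro conjI ballI impI) (fact assms)+

lemma tideal_nonempty: "tideal T I \<Longrightarrow> I \<noteq> {}"
  and tideal_subset: "tideal T I \<Longrightarrow> I \<subseteq> carrier T"
  and tideal_tplus: "\<lbrakk>tideal T I; a \<in> I; b \<in> I\<rbrakk> \<Longrightarrow> tplus T a b \<in> I"
  and tideal_tprod:
    "\<lbrakk>tideal T I; a \<in> carrier T; b \<in> carrier T; c \<in> carrier T; \<alpha> \<in> params T; \<beta> \<in> params T;
      a \<in> I \<or> b \<in> I \<or> c \<in> I\<rbrakk> \<Longrightarrow> tprod T a \<alpha> b \<beta> c \<in> I"
  unfolding tideal_def by simp_all metis

lemma (in ternary_gamma_semiring) tzero_closed: "tzero T \<in> carrier T"
  using monoid.one_closed[OF comm_monoid.axioms(1)[OF additive]] by simp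

text \<open>Without parameters absorption is vacuous: an ideal is then any nonempty additive
  subsemigroup, which may miss \<open>tzero T\<close>.\<close>

lemma (in ternary_gamma_semiring) tzero_in_tideal:
  assumes "tideal T I" and "params T \<noteq> {}"
  shows "tzero T \<in> I"
proof -
  obtain x \<alpha> where x: "x \<in> I" and \<alpha>: "\<alpha> \<in> params T"
    using tideal_nonempty[OF assms(1)] assms(2) by auto
  have xc: "x \<in> carrier T"
    using tideal_subset[OF assms(1)] x by (rule subsetD)
  have "tprod T (tzero T) \<alpha> (tzero T) \<alpha> x \<in> I"
    using assms(1) tzero_closed tzero_closed xc \<alpha> \<alpha> by (rule tideal_tprod) (simp add: x)
  then show ?thesis
    by (simp add: tprod_zero1 tzero_closed xc \<alpha>)
qed

text \<open>The element \<open>tzero T\<close>, common to all members, witnesses nonemptiness. The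
  family must have a member because \<open>\<Inter>{}\<close> is \<open>UNIV\<close>, which need not
  lie in \<open>carrier T\<close>.\<close>

lemma (in ternary_gamma_semiring) tideal_Inter:
  assumes "params T \<noteq> {}" and ideal: "\<And>I. I \<in> \<I> \<Longrightarrow> tideal T I" and "\<I> \<noteq> {}"
  shows "tideal T (\<Inter>\<I>)"
proof (rule tidealI)
  show "\<Inter>\<I> \<noteq> {}"
    using tzero_in_tideal[OF ideal assms(1)] by auto
  show "\<Inter>\<I> \<subseteq> carrier T"
    using tideal_subset[OF ideal] assms(3) by auto
next
  fix a b assume "a \<in> \<Inter>\<I>" "b \<in> \<Inter>\<I>"
  then show "tplus T a b \<in> \<Inter>\<I>"
    by (simp add: ideal tideal_tplus)
next
  fix a b c \<alpha> \<beta>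
  assume "a \<in> carrier T" "b \<in> carrier T" "c \<in> carrier T" "\<alpha> \<in> params T" "\<beta> \<in> params T"
    "a \<in> \<Inter>\<I> \<or> b \<in> \<Inter>\<I> \<or> c \<in> \<Inter>\<I>"
  then show "tprod T a \<alpha> b \<beta> c \<in> \<Inter>\<I>"
    by (auto intro: tideal_tprod[OF ideal])
qed

lemma (in ternary_gamma_semiring) semiprime_Inter_prime:
  assumes "params T \<noteq> {}" and prime: "\<And>P. P \<in> \<P> \<Longrightarrow> prime_tideal T P" and "\<P> \<noteq> {}"
  shows "semiprime_tideal T (\<Inter>\<P>)"
  unfolding semiprime_tideal_def
proof (intro conjI ballI impI)
  have ideal: "tideal T P" and proper: "P \<noteq> carrier T" if "P \<in> \<P>" for P
    using prime[OF that] by (simp_all add: prime_tideal_def)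
  show "tideal T (\<Inter>\<P>)"
    using assms(1) ideal assms(3) by (rule tideal_Inter)
  obtain P where "P \<in> \<P>"
    using assms(3) by auto
  \<comment> \<open>The intersection lies inside the single member \<open>P\<close>, itself strictly
    below \<open>carrier T\<close>.\<close>
  then show "\<Inter>\<P> \<noteq> carrier T"
    using proper tideal_subset[OF ideal] by blast
next
  fix a \<alpha> \<beta>
  assume *: "a \<in> carrier T" "\<alpha> \<in> params T" "\<beta> \<in> params T" and "tprod T a \<alpha> a \<beta> a \<in> \<Inter>\<P>"
  show "a \<in> \<Inter>\<P>"
  proof
    fix P assume "P \<in> \<P>"
    then have "prime_tideal T P" "tprod T a \<alpha> a \<beta> a \<in> P"
      using prime \<open>tprod T a \<alpha> a \<beta> a \<in> \<Inter>\<P>\<close> by auto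
    \<comment> \<open>With all three factors equal to \<open>a\<close>, the three alternatives of
      primeness coincide.\<close>
    with * show "a \<in> P"
      unfolding prime_tideal_def by metis
  qed
qed

text \<open>One maximal ideal already confines the intersection to \<open>carrier T\<close>; this
  makes the results on plain \<open>\<Inter>\<close> applicable to the radical.\<close>

lemma jacobson_radical_eq_Inter:
  assumes "maximal_tideal T M"
  shows "jacobson_radical T = \<Inter>{M. maximal_tideal T M}"
proof -
  have "M \<subseteq> carrier T"
    using assms by (simp add: maximal_tideal_def tideal_subset)
  with assms show ?thesis
    unfolding jacobson_radical_def by blast
qed

text \<open>Both existence conditions in the semiprimeness part matter. Without maximal ideals the
  radical is \<open>carrier T\<close>, which is not proper. Without parameters every maximal ideal
  is vacuously prime, yet on {0, e} with e + e = e the maximal ideals {0} and {e} are disjoint, so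
  the radical is empty.\<close>

theorem proposition5p11:
  fixes T :: "('a, 'g) ternary_gamma"
  assumes "comm_ternary_gamma_semiring T"
  shows "(\<forall>M. maximal_tideal T M \<longrightarrow> jacobson_radical T \<subseteq> M)
    \<and> (params T \<noteq> {} \<and> (\<exists>M. maximal_tideal T M)
        \<and> (\<forall>M. maximal_tideal T M \<longrightarrow> prime_tideal T M)
        \<longrightarrow> semiprime_tideal T (jacobson_radical T))
    \<and> (jacobson_radical T = {tzero T} \<longleftrightarrow> carrier T \<inter> \<Inter>{M. maximal_tideal T M} = {tzero T})
    \<and> (jacobson_radical T = {tzero T} \<longleftrightarrow> semisimple T)"
proof -
  interpret comm_ternary_gamma_semiring T by (fact assms)
  have "semiprime_tideal T (jacobson_radical T)"
    if "params T \<noteq> {}" "maximal_tideal T M" "\<forall>M. maximal_tideal T M \<longrightarrow> prime_tideal T M" for M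
    unfolding jacobson_radical_eq_Inter[OF that(2)]
    by (rule semiprime_Inter_prime) (use that in auto)
  moreover have "\<forall>M. maximal_tideal T M \<longrightarrow> jacobson_radical T \<subseteq> M"
    unfolding jacobson_radical_def by blast
  ultimately show ?thesis
    \<comment> \<open>Both equivalences hold by unfolding: the radical and semisimplicity are
      defined through the same intersection.\<close>
    by (auto simp: semisimple_def jacobson_radical_def)
qed

end
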